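(* For all $p,q\in\mathbb{N}_0$ and all integers $n\ge 1$, \[ \sum_{k=1}^n(-1)^k\binom{p+k}{k}\binom{q+n}{n-k}\,k\,H_{p+k}H_{q+k}= \begin{cases} U_n^{*}, & \text{if } p-q\geq n-1,\\ V_n^{*}, & \text{if } 0\leq p-q<n-1,\\ W_n^{*}, & \text{if } p-q<0, \end{cases} \] where \[ U_n^{*}=(-1)^n(p+1)\binom{p-q}{n-1}\Big\{\big(H_{p-q-n+1}^{\langle 2\rangle}-H_{p-q}^{\langle 2\rangle}\big)+\big(H_{p+1}+H_{p-q}-H_{p-q-n+1}\big)\big(H_{q+n}+H_{p-q}-H_{p-q-n+1}\big)\Big\}, \] \[ V_n^{*}=(-1)^{p-q}(p+1)\frac{(p-q)!\,(q-p+n-2)!}{(n-1)!}\Big\{H_{p+1}+H_{q+n}+2H_{p-q}-2H_{q-p+n-1}+\frac{2}{q-p+n-1}\Big\}, \] \[ W_n^{*}=(-1)^n(p+1)\binom{p-q}{n-1}\Big\{\big(H_{q-p-1}^{\langle 2\rangle}-H_{q-p+n-2}^{\langle 2\rangle}\big)+\big(H_{p+1}+H_{q-p-1}-H_{q-p+n-2}\big)\big(H_{q+n}+H_{q-p-1}-H_{q-p+n-2}\big)\Big\}. \]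
   Context: $\mathbb{N}_0$ denotes the set of nonnegative integers and $\mathbb{N}$ the set of positive integers. For $l\in\mathbb{N}$ the generalized harmonic numbers are $H_0^{\langle l\rangle}=0$ and $H_n^{\langle l\rangle}=\sum_{k=1}^n\frac{1}{k^l}$ for $n\ge 1$. The classical harmonic numbers are $H_n=H_n^{\langle 1\rangle}$, so $H_0=0$ and $H_n=\sum_{k=1}^n\frac1k$. Binomial coefficients with possibly negative upper entry are the generalized ones: $\binom{x}{m}=\frac{x(x-1)\cdots(x-m+1)}{m!}$ for $m\in\mathbb{N}_0$, with $\binom{x}{0}=1$. Each of $U_n^{*},V_n^{*},W_n^{*}$ is only considered in the range of parameters of its own case. *)

theory Defs
  imports "HOL-Analysis.Harmonic_Numbers"
begin

definition gen_harm :: "nat \<Rightarrow> nat \<Rightarrow> real" where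
  "gen_harm l n = (\<Sum>k=1..n. 1 / real k ^ l)"

lemma gen_harm_1: "gen_harm 1 n = harm n"
  by (simp add: gen_harm_def harm_def divide_inverse)

text \<open>
  The natural-number differences below are arranged so that no subtraction truncates in the
  range where the respective expression is used: \<open>p - q \<ge> n - 1\<close> for \<open>U_star\<close>,
  \<open>0 \<le> p - q < n - 1\<close> for \<open>V_star\<close> and \<open>p - q < 0\<close> for \<open>W_star\<close> (as integers, with \<open>n \<ge> 1\<close>).
  Thus \<open>p + 1 - q - n\<close> is \<open>p - q - n + 1\<close>, and \<open>q + n - 2 - p\<close> is \<open>q - p + n - 2\<close>.
\<close>

definition U_star :: "nat \<Rightarrow> nat \<Rightarrow> nat \<Rightarrow> real" where
  "U_star p q n = (-1) ^ n * (real p + 1) * ((real p - real q) gchoose (n - 1)) *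
     ((gen_harm 2 (p + 1 - q - n) - gen_harm 2 (p - q)) +
      (harm (p + 1) + harm (p - q) - harm (p + 1 - q - n)) *
      (harm (q + n) + harm (p - q) - harm (p + 1 - q - n)))"

definition V_star :: "nat \<Rightarrow> nat \<Rightarrow> nat \<Rightarrow> real" where
  "V_star p q n = (-1) ^ (p - q) * (real p + 1) *
     (fact (p - q) * fact (q + n - 2 - p) / fact (n - 1)) *
     (harm (p + 1) + harm (q + n) + 2 * harm (p - q) - 2 * harm (q + n - 1 - p) +
      2 / (real q - real p + real n - 1))"

definition W_star :: "nat \<Rightarrow> nat \<Rightarrow> nat \<Rightarrow> real" where
  "W_star p q n = (-1) ^ n * (real p + 1) * ((real p - real q) gchoose (n - 1)) *
     ((gen_harm 2 (q - p - 1) - gen_harm 2 (q + n - 2 - p)) +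
      (harm (p + 1) + harm (q - p - 1) - harm (q + n - 2 - p)) *
      (harm (q + n) + harm (q - p - 1) - harm (q + n - 2 - p)))"

end

theory Submission
  imports Defs "HOL-Computational_Algebra.Polynomial"
begin

text \<open>
  Differences of harmonic numbers are logarithmic derivatives of binomial coefficients: for natural
  numbers \<open>p\<close>, \<open>q\<close> and \<open>k \<le> n\<close>, the \<open>x\<close>-derivative of \<open>x + k gchoose k\<close> at \<open>p\<close> is
  \<open>(p + k choose k) (H\<^bsub>p+k\<^esub> - H\<^bsub>p\<^esub>)\<close>, and the \<open>y\<close>-derivative of \<open>y + n gchoose (n - k)\<close> at \<open>q\<close>
  is \<open>(q + n choose (n - k)) (H\<^bsub>q+n\<^esub> - H\<^bsub>q+k\<^esub>)\<close>. So the sum comes out of the identity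
  \[ \sum_{k=1}^n (-1)^k k \binom{x+k}{k} \binom{y+n}{n-k} = (-1)^n (x+1) \binom{x-y}{n-1} \]
  in real \<open>x\<close> and \<open>y\<close>, a form of the Chu--Vandermonde convolution
  (lemma \<open>alternating_vandermonde\<close>), by applying \<open>1\<close>, \<open>d/dx\<close>, \<open>d/dy\<close> and \<open>d\<^sup>2/dxdy\<close>
  and combining the four results at \<open>(p, q)\<close> linearly.

  As the right-hand side depends on \<open>y\<close> only through \<open>x - y\<close>, the outcome, with
  \<open>G(t) = (t gchoose (n - 1))\<close> and its derivatives taken at \<open>t = p - q\<close>, is
  \[ (-1)^n (p+1) \{ G'' + (H_{p+1} + H_{q+n}) G' + H_{p+1} H_{q+n} G \} \]
  (lemma \<open>harmonic_sum_via_derivatives\<close>). The three cases of the theorem reflect the position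
  of \<open>p - q\<close> relative to the zeros \<open>0, \<dots>, n - 2\<close> of \<open>G\<close>. Above or below all of them,
  \<open>G'/G\<close> and \<open>G''/G\<close> are given by the power sums of \<open>1 / (t - i)\<close>, which are differences of
  harmonic numbers. At a zero, \<open>G\<close> itself vanishes, and \<open>G'\<close> and \<open>G''\<close> come from the cofactor
  of the vanishing linear factor.
\<close>

section \<open>Derivatives of products of linear factors\<close>

lemma pderiv_linear_mult:
  "pderiv ([:-a, 1:] * Q) = Q + [:-a, 1:] * pderiv (Q :: real poly)"
  by (simp only: pderiv_mult) (simp add: pderiv_pCons algebra_simps)

lemma poly_pderiv_prod_linear:
  fixes a :: "'i \<Rightarrow> real"
  assumes "finite I" "\<And>i. i \<in> I \<Longrightarrow> t \<noteq> a i"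
  shows "poly (pderiv (\<Prod>i\<in>I. [:- a i, 1:])) t =
           poly (\<Prod>i\<in>I. [:- a i, 1:]) t * (\<Sum>i\<in>I. 1 / (t - a i))"
  using assms
proof (induction I rule: finite_induct)
  case (insert j I)
  define Q where "Q = (\<Prod>i\<in>I. [:- a i, 1:])"
  have "t - a j \<noteq> 0" using insert.prems by simp
  moreover have "poly (pderiv Q) t = poly Q t * (\<Sum>i\<in>I. 1 / (t - a i))"
    unfolding Q_def using insert by simp
  ultimately show ?case
    using insert.hyps
    by (simp add: pderiv_linear_mult Q_def[symmetric] del: mult_pCons_left)
       (simp add: field_simps)
qed auto

text \<open>
  Differentiating the logarithmic derivative \<open>P'/P = \<Sum> 1/(t - a\<^sub>i)\<close> once more gives
  \<open>P''/P - (P'/P)\<^sup>2 = - \<Sum> 1/(t - a\<^sub>i)\<^sup>2\<close>.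
\<close>

lemma poly_pderiv2_prod_linear:
  fixes a :: "'i \<Rightarrow> real"
  assumes "finite I" "\<And>i. i \<in> I \<Longrightarrow> t \<noteq> a i"
  shows "poly (pderiv (pderiv (\<Prod>i\<in>I. [:- a i, 1:]))) t =
           poly (\<Prod>i\<in>I. [:- a i, 1:]) t *
             ((\<Sum>i\<in>I. 1 / (t - a i))\<^sup>2 - (\<Sum>i\<in>I. 1 / (t - a i) ^ 2))"
  using assms
proof (induction I rule: finite_induct)
  case (insert j I)
  define Q where "Q = (\<Prod>i\<in>I. [:- a i, 1:])"
  define S where "S = (\<Sum>i\<in>I. 1 / (t - a i))"
  define S2 where "S2 = (\<Sum>i\<in>I. 1 / (t - a i) ^ 2)"
  define d where "d = t - a j"
  have d: "d \<noteq> 0" using insert.prems by (simp add: d_def)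
  have 1: "poly (pderiv Q) t = poly Q t * S"
    unfolding Q_def S_def using insert by (intro poly_pderiv_prod_linear) auto
  have 2: "poly (pderiv (pderiv Q)) t = poly Q t * (S\<^sup>2 - S2)"
    unfolding Q_def S_def S2_def using insert by simp
  have "poly (pderiv (pderiv ([:- a j, 1:] * Q))) t =
          2 * poly (pderiv Q) t + d * poly (pderiv (pderiv Q)) t"
    by (simp add: pderiv_linear_mult pderiv_add d_def del: mult_pCons_left)
  also have "\<dots> = d * poly Q t * ((1 / d + S)\<^sup>2 - (1 / d ^ 2 + S2))"
    using d unfolding 1 2 by (simp add: field_simps power2_eq_square)
  also have "d * poly Q t = poly ([:- a j, 1:] * Q) t"
    by (simp add: d_def algebra_simps)
  finally show ?case
    using insert.hyps by (simp add: Q_def S_def S2_def d_def del: mult_pCons_left)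
qed auto

section \<open>The binomial coefficient as a polynomial in its upper entry\<close>

text \<open>
  As a polynomial, the binomial coefficient has iterated derivatives that are again explicit
  polynomials, and its linear factors are at hand for the product formulas above.
\<close>

definition gbinomial_poly :: "nat \<Rightarrow> real poly" where
  "gbinomial_poly m = smult (1 / fact m) (\<Prod>i<m. [:- real i, 1:])"

lemma poly_gbinomial_poly: "poly (gbinomial_poly m) x = (x gchoose m)"
  by (simp add: gbinomial_poly_def gbinomial_prod_rev poly_prod atLeast0LessThan)

lemma gbinomial_poly_derivs_nonzero:
  assumes "\<forall>i<m. t \<noteq> real i"
  shows "poly (pderiv (gbinomial_poly m)) t = (t gchoose m) * (\<Sum>i<m. 1 / (t - real i))"
    and "poly (pderiv (pderiv (gbinomial_poly m))) t =
           (t gchoose m) * ((\<Sum>i<m. 1 / (t - real i))\<^sup>2 - (\<Sum>i<m. 1 / (t - real i) ^ 2))"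
proof -
  define P where "P = (\<Prod>i<m. [:- real i, 1:])"
  have derivs: "poly (pderiv P) t = poly P t * (\<Sum>i<m. 1 / (t - real i))"
    "poly (pderiv (pderiv P)) t =
       poly P t * ((\<Sum>i<m. 1 / (t - real i))\<^sup>2 - (\<Sum>i<m. 1 / (t - real i) ^ 2))"
    unfolding P_def using assms
    by (auto intro!: poly_pderiv_prod_linear poly_pderiv2_prod_linear)
  show "poly (pderiv (gbinomial_poly m)) t = (t gchoose m) * (\<Sum>i<m. 1 / (t - real i))"
    and "poly (pderiv (pderiv (gbinomial_poly m))) t =
           (t gchoose m) * ((\<Sum>i<m. 1 / (t - real i))\<^sup>2 - (\<Sum>i<m. 1 / (t - real i) ^ 2))"
    unfolding poly_gbinomial_poly[symmetric] gbinomial_poly_def P_def[symmetric]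
    by (simp_all add: pderiv_smult derivs)
qed

text \<open>
  At a zero \<open>t\<close> of \<open>P = (X - t) Q\<close>, one has \<open>P'(t) = Q(t)\<close> and \<open>P''(t) = 2 Q'(t)\<close>.
\<close>

lemma gbinomial_poly_derivs_zero:
  assumes "t < m"
  defines "J \<equiv> {..<m} - {t}"
  shows "poly (pderiv (gbinomial_poly m)) (real t) = (\<Prod>i\<in>J. real t - real i) / fact m"
    and "poly (pderiv (pderiv (gbinomial_poly m))) (real t) =
           2 * ((\<Prod>i\<in>J. real t - real i) / fact m) * (\<Sum>i\<in>J. 1 / (real t - real i))"
proof -
  define Q where "Q = (\<Prod>i\<in>J. [:- real i, 1:])"
  have P: "gbinomial_poly m = smult (1 / fact m) ([:- real t, 1:] * Q)"
    unfolding gbinomial_poly_def Q_def J_def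
    using assms by (subst prod.remove[of _ t]) auto
  have Q: "poly Q (real t) = (\<Prod>i\<in>J. real t - real i)"
    by (simp add: Q_def poly_prod)
  have Q': "poly (pderiv Q) (real t) = poly Q (real t) * (\<Sum>i\<in>J. 1 / (real t - real i))"
    unfolding Q_def by (rule poly_pderiv_prod_linear) (auto simp: J_def)
  show "poly (pderiv (gbinomial_poly m)) (real t) = (\<Prod>i\<in>J. real t - real i) / fact m"
    unfolding P by (simp add: pderiv_smult pderiv_linear_mult Q del: mult_pCons_left)
  show "poly (pderiv (pderiv (gbinomial_poly m))) (real t) =
           2 * ((\<Prod>i\<in>J. real t - real i) / fact m) * (\<Sum>i\<in>J. 1 / (real t - real i))"
    unfolding P
    by (simp add: pderiv_smult pderiv_linear_mult pderiv_add Q Q' del: mult_pCons_left)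
qed

section \<open>Harmonic numbers from sums over the zeros of a binomial coefficient\<close>

lemma gen_harm_Suc: "gen_harm l (Suc n) = gen_harm l n + 1 / real (Suc n) ^ l"
  by (simp add: gen_harm_def)

lemma sum_inverse_powers_above:
  assumes "m \<le> t"
  shows "(\<Sum>i<m. 1 / (real t - real i) ^ l) = gen_harm l t - gen_harm l (t - m)"
  using assms
proof (induction m)
  case (Suc m)
  have "t - m = Suc (t - Suc m)" using Suc.prems by simp
  hence "gen_harm l (t - m) = gen_harm l (t - Suc m) + 1 / (real t - real m) ^ l"
    using Suc.prems by (simp add: gen_harm_Suc of_nat_diff)
  thus ?case using Suc by simp
qed simp

lemma sum_inverse_powers_below:
  "(\<Sum>i<m. 1 / (- real (Suc s) - real i) ^ l) = (-1) ^ l * (gen_harm l (s + m) - gen_harm l s)"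
proof (induction m)
  case (Suc m)
  have "- real (Suc s) - real m = (-1) * real (Suc (s + m))" by simp
  hence "1 / (- real (Suc s) - real m) ^ l = (-1) ^ l * (1 / real (Suc (s + m)) ^ l)"
    by (simp only: power_mult_distrib) (simp add: divide_simps flip: power_add mult_2)
  thus ?case using Suc by (simp add: gen_harm_Suc algebra_simps)
qed simp

lemma sum_inverse_at_zero:
  "(\<Sum>i\<in>{..<Suc (t + r)} - {t}. 1 / (real t - real i)) = harm t - harm r"
proof (induction r)
  case 0
  have "{..<Suc t} - {t} = {..<t}" by auto
  thus ?case using sum_inverse_powers_above[of t t 1] gen_harm_1[of t]
    by (simp add: gen_harm_def harm_def)
next
  case (Suc r)
  have "{..<Suc (t + Suc r)} - {t} = insert (t + Suc r) ({..<Suc (t + r)} - {t})" by auto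
  moreover have "1 / (real t - real (t + Suc r)) = - inverse (real (Suc r))"
  proof -
    have "real t - real (t + Suc r) = - real (Suc r)" by simp
    thus ?thesis by (simp only: inverse_eq_divide minus_divide_right)
  qed
  ultimately show ?case using Suc by (simp add: harm_Suc del: of_nat_Suc of_nat_add)
qed

lemma prod_at_zero:
  "(\<Prod>i\<in>{..<Suc (t + r)} - {t}. real t - real i) = (-1) ^ r * fact t * fact r"
proof (induction r)
  case 0
  have "{..<Suc t} - {t} = {..<t}" by auto
  moreover have "(\<Prod>i<t. real t - real i) = fact t"
    by (simp add: fact_prod_rev of_nat_diff atLeast0LessThan)
  ultimately show ?case by simp
next
  case (Suc r)
  have "{..<Suc (t + Suc r)} - {t} = insert (t + Suc r) ({..<Suc (t + r)} - {t})" by auto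
  thus ?case using Suc by (simp add: algebra_simps)
qed

lemma poly_pderiv_gbinomial_poly_of_nat:
  assumes "m \<le> t"
  shows "poly (pderiv (gbinomial_poly m)) (real t) = real (t choose m) * (harm t - harm (t - m))"
proof -
  have "(\<Sum>i<m. 1 / (real t - real i)) = harm t - harm (t - m)"
    using sum_inverse_powers_above[OF assms, of 1]
    by (simp add: gen_harm_1[simplified])
  thus ?thesis using assms
    by (subst gbinomial_poly_derivs_nonzero(1)) (auto simp: binomial_gbinomial)
qed

section \<open>Differentiating the Chu--Vandermonde convolution\<close>

text \<open>
  After absorbing the factor \<open>k\<close> and negating an upper entry,
  \<open>(-1)\<^sup>k k (x + k gchoose k) = - (x + 1) (- x - 2 gchoose (k - 1))\<close>, and the sum is an ordinary
  Vandermonde convolution.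
\<close>

lemma alternating_vandermonde:
  fixes x y :: real
  assumes "n \<ge> 1"
  shows "(\<Sum>k=1..n. (-1) ^ k * real k * (x + real k gchoose k) * (y + real n gchoose (n - k))) =
           (-1) ^ n * (x + 1) * (x - y gchoose (n - 1))"
proof -
  obtain m where n: "n = Suc m" using assms by (cases n) auto
  have absorb: "(-1) ^ Suc j * real (Suc j) * (x + real (Suc j) gchoose Suc j) =
                  - (x + 1) * (- x - 2 gchoose j)" for j
  proof -
    have "(- x - 2 gchoose j) = (-1) ^ j * (x + 1 + real j gchoose j)"
      by (subst gbinomial_negated_upper) (simp add: algebra_simps)
    moreover have "real (Suc j) * (x + real (Suc j) gchoose Suc j) =
                     (x + 1) * (x + 1 + real j gchoose j)"
    proof -
      have "(x + real (Suc j) gchoose Suc j) = pochhammer (x + 1) (Suc j) / fact (Suc j)"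
        by (subst gbinomial_pochhammer') simp
      moreover have "(x + 1 + real j gchoose j) = pochhammer (x + 2) j / fact j"
        by (subst gbinomial_pochhammer') (simp add: algebra_simps)
      ultimately show ?thesis
        by (simp add: pochhammer_rec add.commute add.left_commute del: of_nat_Suc)
    qed
    ultimately show ?thesis
      by (simp only: power_Suc mult.assoc) (simp add: algebra_simps)
  qed
  have "(\<Sum>k=1..n. (-1) ^ k * real k * (x + real k gchoose k) * (y + real n gchoose (n - k))) =
        (\<Sum>j\<le>m. (-1) ^ Suc j * real (Suc j) * (x + real (Suc j) gchoose Suc j) *
                 (y + real n gchoose (m - j)))"
    unfolding n One_nat_def sum.shift_bounds_cl_Suc_ivl atMost_atLeast0 diff_Suc_Suc by (rule refl)
  also have "\<dots> = - (x + 1) * (\<Sum>j\<le>m. (- x - 2 gchoose j) * (y + real n gchoose (m - j)))"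
    unfolding absorb by (simp add: sum_distrib_left mult.assoc)
  also have "(\<Sum>j\<le>m. (- x - 2 gchoose j) * (y + real n gchoose (m - j))) =
             (- x - 2 + (y + real n) gchoose m)"
    by (simp only: gbinomial_Vandermonde atMost_atLeast0)
  also have "\<dots> = (-1) ^ m * (x - y gchoose m)"
    by (subst gbinomial_negated_upper) (simp add: n algebra_simps)
  finally show ?thesis by (simp add: n algebra_simps)
qed

lemma DERIV_poly_shift:
  "((\<lambda>x. poly P (x + c)) has_real_derivative poly (pderiv P) (x + c)) (at (x::real))"
  using poly_DERIV DERIV_shift by blast

lemma DERIV_poly_reflect:
  "((\<lambda>y. poly P (c - y)) has_real_derivative - poly (pderiv P) (c - y)) (at (y::real))"
proof -
  have "((\<lambda>y. c - y) has_real_derivative - 1) (at y)"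
    by (auto intro!: derivative_eq_intros)
  from DERIV_chain2[OF poly_DERIV this, of P] show ?thesis by simp
qed

text \<open>
  Both sides of the convolution are polynomial functions of \<open>x\<close> and \<open>y\<close>, so it may be differentiated
  summand by summand in either variable.
\<close>

context
  fixes n m :: nat
  assumes n: "n = Suc m"
begin

lemma vandermonde_poly:
  "(\<Sum>k=1..n. (-1) ^ k * real k * poly (gbinomial_poly k) (x + real k) *
       poly (gbinomial_poly (n - k)) (y + real n)) =
     (-1) ^ n * (x + 1) * poly (gbinomial_poly m) (x - y)"
  using alternating_vandermonde[of n x y] by (simp add: n poly_gbinomial_poly)

lemma vandermonde_dy:
  "(\<Sum>k=1..n. (-1) ^ k * real k * poly (gbinomial_poly k) (x + real k) *
       poly (pderiv (gbinomial_poly (n - k))) (y + real n)) =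
     - ((-1) ^ n * (x + 1) * poly (pderiv (gbinomial_poly m)) (x - y))"
proof (rule DERIV_unique)
  show "((\<lambda>y. (-1) ^ n * (x + 1) * poly (gbinomial_poly m) (x - y)) has_real_derivative
           - ((-1) ^ n * (x + 1) * poly (pderiv (gbinomial_poly m)) (x - y))) (at y)"
    using DERIV_cmult[OF DERIV_poly_reflect, of "(-1) ^ n * (x + 1)" "gbinomial_poly m" x y] by simp
  show "((\<lambda>y. (-1) ^ n * (x + 1) * poly (gbinomial_poly m) (x - y)) has_real_derivative
           (\<Sum>k=1..n. (-1) ^ k * real k * poly (gbinomial_poly k) (x + real k) *
              poly (pderiv (gbinomial_poly (n - k))) (y + real n))) (at y)"
    unfolding vandermonde_poly[symmetric]
    by (intro DERIV_sum DERIV_cmult DERIV_poly_shift)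
qed

text \<open>
  The weights \<open>c k\<close> stand for the factors that depend on \<open>y\<close> alone. Leaving them arbitrary, and \<open>P\<close> with
  them, lets the same computation differentiate both the convolution and its \<open>y\<close>-derivative.
\<close>

lemma vandermonde_sum_differentiate_x:
  assumes "\<And>x::real. (\<Sum>k=1..n. (-1) ^ k * real k * poly (gbinomial_poly k) (x + real k) * c k) =
             d * ((x + 1) * poly P (x - y))"
  shows "(\<Sum>k=1..n. (-1) ^ k * real k * poly (pderiv (gbinomial_poly k)) (x + real k) * c k) =
           d * (poly P (x - y) + (x + 1) * poly (pderiv P) (x - y))"
proof (rule DERIV_unique)
  have "((\<lambda>x. poly P (x - y)) has_real_derivative poly (pderiv P) (x - y)) (at x)"
    using DERIV_poly_shift[of P "- y" x] by simp
  thus "((\<lambda>x. d * ((x + 1) * poly P (x - y))) has_real_derivative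
          d * (poly P (x - y) + (x + 1) * poly (pderiv P) (x - y))) (at x)"
    by (auto intro!: derivative_eq_intros)
  show "((\<lambda>x. d * ((x + 1) * poly P (x - y))) has_real_derivative
          (\<Sum>k=1..n. (-1) ^ k * real k * poly (pderiv (gbinomial_poly k)) (x + real k) * c k)) (at x)"
    unfolding assms[symmetric]
    by (intro DERIV_sum DERIV_cmult DERIV_cmult_right DERIV_poly_shift)
qed

lemma vandermonde_dx:
  "(\<Sum>k=1..n. (-1) ^ k * real k * poly (pderiv (gbinomial_poly k)) (x + real k) *
       poly (gbinomial_poly (n - k)) (y + real n)) =
     (-1) ^ n * (poly (gbinomial_poly m) (x - y) + (x + 1) * poly (pderiv (gbinomial_poly m)) (x - y))"
  by (rule vandermonde_sum_differentiate_x) (simp only: vandermonde_poly)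

lemma vandermonde_dxdy:
  "(\<Sum>k=1..n. (-1) ^ k * real k * poly (pderiv (gbinomial_poly k)) (x + real k) *
       poly (pderiv (gbinomial_poly (n - k))) (y + real n)) =
     - ((-1) ^ n) * (poly (pderiv (gbinomial_poly m)) (x - y) +
       (x + 1) * poly (pderiv (pderiv (gbinomial_poly m))) (x - y))"
  by (rule vandermonde_sum_differentiate_x) (simp only: vandermonde_dy)

text \<open>
  Writing \<open>H\<^bsub>p+k\<^esub> = (H\<^bsub>p+k\<^esub> - H\<^bsub>p\<^esub>) + H\<^bsub>p\<^esub>\<close> and \<open>H\<^bsub>q+k\<^esub> = H\<^bsub>q+n\<^esub> - (H\<^bsub>q+n\<^esub> - H\<^bsub>q+k\<^esub>)\<close> turns each
  summand into a combination of the summands of the four identities above. The extra terms that the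
  factor \<open>x + 1\<close> contributes under \<open>d/dx\<close> raise \<open>H\<^bsub>p\<^esub>\<close> to \<open>H\<^bsub>p+1\<^esub>\<close>.
\<close>

lemma harmonic_sum_via_derivatives:
  fixes p q :: nat
  defines "t \<equiv> real p - real q"
  shows "(\<Sum>k=1..n. (-1) ^ k * real ((p + k) choose k) * real ((q + n) choose (n - k)) *
            real k * harm (p + k) * harm (q + k)) =
         (-1) ^ n * (real p + 1) *
           (poly (pderiv (pderiv (gbinomial_poly m))) t +
            (harm (p + 1) + harm (q + n)) * poly (pderiv (gbinomial_poly m)) t +
            harm (p + 1) * harm (q + n) * (t gchoose m))"
proof -
  let ?B = gbinomial_poly
  let ?s = "\<lambda>P Q k. (-1) ^ k * real k * poly (P k) (real p + real k) *
                      poly (Q (n - k)) (real q + real n)"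
  let ?B' = "\<lambda>k. pderiv (?B k)"
  have summand: "(-1) ^ k * real ((p + k) choose k) * real ((q + n) choose (n - k)) *
            real k * harm (p + k) * harm (q + k) =
          harm (q + n) * ?s ?B' ?B k - ?s ?B' ?B' k + harm p * harm (q + n) * ?s ?B ?B k
          - harm p * ?s ?B ?B' k" if k: "k \<in> {1..n}" for k
  proof -
    have 1: "poly (?B k) (real p + real k) = real ((p + k) choose k)"
      by (simp add: poly_gbinomial_poly binomial_gbinomial)
    have 2: "poly (?B (n - k)) (real q + real n) = real ((q + n) choose (n - k))"
      by (simp add: poly_gbinomial_poly binomial_gbinomial)
    have 3: "poly (?B' k) (real p + real k) = real ((p + k) choose k) * (harm (p + k) - harm p)"
      using poly_pderiv_gbinomial_poly_of_nat[of k "p + k"] by simp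
    have "q + n - (n - k) = q + k" using k by simp
    hence 4: "poly (?B' (n - k)) (real q + real n) =
                real ((q + n) choose (n - k)) * (harm (q + n) - harm (q + k))"
      using poly_pderiv_gbinomial_poly_of_nat[of "n - k" "q + n"] by simp
    show ?thesis unfolding 1 2 3 4 by (simp add: algebra_simps)
  qed
  have "harm (p + 1) = harm p + 1 / (real p + 1)"
    by (simp add: harm_Suc inverse_eq_divide add.commute)
  hence Hp: "(real p + 1) * harm p = (real p + 1) * harm (p + 1) - 1"
    by (simp add: field_simps)
  define e where "e = (-1::real) ^ n"
  have "(\<Sum>k=1..n. (-1) ^ k * real ((p + k) choose k) * real ((q + n) choose (n - k)) *
            real k * harm (p + k) * harm (q + k)) =
        harm (q + n) * (\<Sum>k=1..n. ?s ?B' ?B k) - (\<Sum>k=1..n. ?s ?B' ?B' k)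
        + harm p * harm (q + n) * (\<Sum>k=1..n. ?s ?B ?B k) - harm p * (\<Sum>k=1..n. ?s ?B ?B' k)"
    by (simp only: summand sum.distrib sum_subtractf sum_distrib_left cong: sum.cong)
  also have "\<dots> = e * ((real p + 1) * poly (pderiv (?B' m)) t
      + (1 + (real p + 1) * harm p + (real p + 1) * harm (q + n)) * poly (?B' m) t
      + (1 + (real p + 1) * harm p) * harm (q + n) * poly (?B m) t)"
    unfolding vandermonde_poly vandermonde_dx vandermonde_dy vandermonde_dxdy t_def[symmetric]
      e_def[symmetric]
    by algebra
  also have "\<dots> = e * (real p + 1) * (poly (pderiv (?B' m)) t
      + (harm (p + 1) + harm (q + n)) * poly (?B' m) t + harm (p + 1) * harm (q + n) * poly (?B m) t)"
    unfolding Hp by (simp add: algebra_simps)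
  finally show ?thesis by (simp add: poly_gbinomial_poly e_def)
qed

end

section \<open>The three positions of the argument relative to the zeros\<close>

theorem theorem6:
  fixes p q n :: nat
  assumes "n \<ge> 1"
  shows "(\<Sum>k=1..n. (-1) ^ k * real ((p + k) choose k) * real ((q + n) choose (n - k)) *
            real k * harm (p + k) * harm (q + k)) =
         (if int p - int q \<ge> int n - 1 then U_star p q n
          else if 0 \<le> int p - int q \<and> int p - int q < int n - 1 then V_star p q n
          else W_star p q n)"
proof -
  obtain m where n: "n = Suc m" using assms by (cases n) auto
  note sum_eq = harmonic_sum_via_derivatives[OF n, of p q]
  note H1 = gen_harm_1[simplified]
  consider (U) "q + m \<le> p" | (V) "q \<le> p" "p < q + m" | (W) "p < q" by linarith
  thus ?thesis
  proof cases
    case U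
    define t where "t = p - q"
    have t: "real p - real q = real t" "m \<le> t"
      using U by (auto simp: t_def of_nat_diff)
    have nz: "\<forall>i<m. real t \<noteq> real i" using t(2) by simp
    have idx: "p + 1 - q - n = t - m" using n by (simp add: t_def)
    have "U_star p q n = (-1) ^ n * (real p + 1) * (real t gchoose m) *
       ((gen_harm 2 (t - m) - gen_harm 2 t) +
        (harm (p + 1) + harm t - harm (t - m)) * (harm (q + n) + harm t - harm (t - m)))"
      unfolding U_star_def idx t(1) t_def[symmetric] by (simp add: n)
    moreover have "int p - int q \<ge> int n - 1" using U n by simp
    ultimately show ?thesis
      unfolding sum_eq t(1) gbinomial_poly_derivs_nonzero[OF nz]
      using sum_inverse_powers_above[OF t(2), of 1] sum_inverse_powers_above[OF t(2), of 2]
      by (simp add: H1 power2_eq_square, simp add: algebra_simps)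
  next
    case V
    define t where "t = p - q"
    \<comment> \<open>The zeros of \<open>gbinomial_poly m\<close> are \<open>0, \<dots>, m - 1\<close>: \<open>t\<close> lie below \<open>t\<close>, and \<open>r\<close> above it.\<close>
    define r where "r = q + m - p - 1"
    have t: "real p - real q = real t" "p - q = t"
      using V by (auto simp: t_def of_nat_diff)
    have m: "m = Suc (t + r)" using V by (simp add: t_def r_def)
    have zero: "(real t gchoose m) = 0"
      using m by (simp add: binomial_gbinomial[symmetric] binomial_eq_0)
    have idx: "q + n - 2 - p = r" "q + n - 1 - p = Suc r" "n - 1 = m"
      using V n by (auto simp: r_def)
    have den: "real q - real p + real n - 1 = real (Suc r)"
      using t(1) n m by simp
    \<comment> \<open>The fraction in \<open>V_star\<close> lowers the index of its last harmonic number from \<open>r + 1\<close> to \<open>r\<close>.\<close>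
    have H: "2 * harm (Suc r) = 2 * harm r + 2 / real (Suc r)"
      by (simp add: harm_Suc divide_simps)
    have sgn: "(-1::real) ^ n * (-1) ^ r = (-1) ^ t"
      by (simp add: n m power_add flip: power_mult_distrib)
    define c :: real where "c = (-1) ^ r * fact t * fact r / fact m"
    have "t < m" using m by simp
    note derivs = gbinomial_poly_derivs_zero[OF this]
    have d1: "poly (pderiv (gbinomial_poly m)) (real t) = c"
      unfolding derivs c_def by (simp only: m prod_at_zero)
    have d2: "poly (pderiv (pderiv (gbinomial_poly m))) (real t) = 2 * c * (harm t - harm r)"
      unfolding derivs c_def by (simp only: m prod_at_zero sum_inverse_at_zero)
    have "V_star p q n = ((-1) ^ n * (-1) ^ r) * (real p + 1) * (fact t * fact r / fact m) *
            (harm (p + 1) + harm (q + n) + 2 * harm t - 2 * harm r)"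
      unfolding V_star_def idx den t(2) H sgn by simp
    hence "V_star p q n = (-1) ^ n * (real p + 1) * c *
            (harm (p + 1) + harm (q + n) + 2 * harm t - 2 * harm r)"
      by (simp add: c_def)
    moreover have "\<not> int p - int q \<ge> int n - 1" "0 \<le> int p - int q \<and> int p - int q < int n - 1"
      using V n by auto
    ultimately show ?thesis
      unfolding sum_eq t(1) zero d1 d2 by (simp add: algebra_simps)
  next
    case W
    define s where "s = q - p - 1"
    have t: "real p - real q = - real (Suc s)" using W by (simp add: s_def of_nat_diff)
    have nz: "\<forall>i<m. - real (Suc s) \<noteq> real i" by (simp add: add_eq_0_iff)
    have idx: "q + n - 2 - p = s + m" "n - 1 = m" using W n by (auto simp: s_def)
    have "\<not> int p - int q \<ge> int n - 1" "\<not> (0 \<le> int p - int q \<and> int p - int q < int n - 1)"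
      using W n by auto
    moreover have "W_star p q n = (-1) ^ n * (real p + 1) * (- real (Suc s) gchoose m) *
       ((gen_harm 2 s - gen_harm 2 (s + m)) +
        (harm (p + 1) + harm s - harm (s + m)) * (harm (q + n) + harm s - harm (s + m)))"
      unfolding W_star_def idx t s_def[symmetric] by simp
    ultimately show ?thesis
      unfolding sum_eq t gbinomial_poly_derivs_nonzero[OF nz]
      using sum_inverse_powers_below[where s = s and m = m and l = 1] 
        sum_inverse_powers_below[where s = s and m = m and l = 2]
      by (simp add: H1 power2_eq_square del: of_nat_Suc, simp add: algebra_simps)
  qed
qed

end
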